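(* Let $\varphi(z)=\sum_{k=1}^{\infty}\alpha_kz^k$ and $\psi(z)=\sum_{k=0}^{\infty}\beta_kz^k$ be holomorphic in the open unit disk $\mathbb{D}$ with $\alpha_1\neq0$, $\beta_0\neq0$. Put $b:=\frac{1}{\alpha_1\beta_0}$, $\widetilde{\alpha}:=2\alpha_2^2-\alpha_1\alpha_3$ and $\widetilde{\beta}:=2\beta_1^2-\beta_0\beta_2$. Let $F\in\mathcal{A}_{\varphi,\psi}$, $F(z)=\varphi(z)\psi(\omega(z))$ with $\omega$ a holomorphic self-mapping of $\mathbb{D}$, $\omega(0)=0$, let $\gamma_1=\omega'(0)$, and let $G=F^{-1}\in\mathcal{B}_{\varphi,\psi}$, $G(z)=\sum_{k=1}^{\infty}b_kz^k$. Put $$c_1=b^5\left[\beta_0^2\widetilde{\alpha}+3\alpha_1\beta_0\alpha_2\beta_1\gamma_1+\alpha_1^2\widetilde{\beta}\gamma_1^2\right],\quad \rho_1=|b|^4|\alpha_1\beta_1|\left(1-|\gamma_1|^2\right),$$ $$c_2=b^5\beta_0^2\widetilde{\alpha},\quad \rho_2=|b|^4|\alpha_1\beta_2|.$$ If $\beta_1\neq0$, then $b_3$ lies on the circle $\partial D_{\rho_1}(c_1)$ if and only if either (i) there exists $\xi\in\mathbb{R}$ such that $b_2=-(\alpha_2\beta_0+\alpha_1\beta_1e^{i\xi})b^3$; in this case $b_3=c_1$ and $F(z)=\varphi(z)\psi(\omega(z))$ with $\omega(z)=e^{i\xi}z$, or (ii) there exists $\theta\in\mathbb{R}$ such that $F(z)=\varphi(z)\psi(\omega(z))$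 with $\omega(z)=z\,\frac{\gamma_1+ze^{i\theta}}{1+\overline{\gamma_1}ze^{i\theta}}$. If $\beta_1=\beta_2=0$, then $b_3=b^5\beta_0^2\widetilde{\alpha}$. If $\beta_1=0$ and $\beta_2\neq0$, then $b_3$ lies on the circle $\partial D_{\rho_2}(c_2)$ if and only if there exists $\theta\in\mathbb{R}$ such that $G$ is the inverse function to $F\in\mathcal{A}_{\varphi,\psi}$ defined by $F(z)=\varphi(z)\psi(e^{i\theta}z)$, and then $b_3=\widetilde{\alpha}\beta_0^2b^5-\alpha_1\beta_2e^{2i\theta}b^4$.
   Context: $\mathcal{A}_{\varphi,\psi}$ is the class of functions $F$ holomorphic in $\mathbb{D}$ of the form $F(z)=\varphi(z)\psi(\omega(z))$, $z\in\mathbb{D}$, for some holomorphic self-mapping $\omega$ of $\mathbb{D}$ with $\omega(0)=0$. Since $F(0)=0$ and $F'(0)=\alpha_1\beta_0\neq0$, $F$ has a local inverse $F^{-1}$ near zero with $F^{-1}(0)=0$, and $\mathcal{B}_{\varphi,\psi}:=\{F^{-1}:F\in\mathcal{A}_{\varphi,\psi}\}$. $D_\rho(c)$ denotes the disk of radius $\rho$ centered at $c$, and $\partial D_\rho(c)=\{z:|z-c|=\rho\}$, which is the single point $c$ if $\rho=0$. The number $\gamma_1=\omega'(0)$ (which satisfies $|\gamma_1|\le1$) is the first Schur parameter of $\omega$. *)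

theory Defs
  imports "HOL-Complex_Analysis.Complex_Analysis"
begin

text \<open>Functions on the unit disk and germs at 0 are rendered as total functions on the complex
  plane; only their values on the disk, respectively near 0, are ever constrained.\<close>

definition disk_self_map0 :: "(complex \<Rightarrow> complex) \<Rightarrow> bool" where
  "disk_self_map0 \<omega> \<longleftrightarrow>
     \<omega> holomorphic_on ball 0 1 \<and> \<omega> ` ball 0 1 \<subseteq> ball 0 1 \<and> \<omega> 0 = 0"

definition class_A :: "(complex \<Rightarrow> complex) \<Rightarrow> (complex \<Rightarrow> complex) \<Rightarrow> (complex \<Rightarrow> complex) set" where
  "class_A \<phi> \<psi> =
     {F. F holomorphic_on ball 0 1 \<and>
         (\<exists>\<omega>. disk_self_map0 \<omega> \<and> (\<forall>z\<in>ball 0 1. F z = \<phi> z * \<psi> (\<omega> z)))}"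

definition local_inverse_at0 :: "(complex \<Rightarrow> complex) \<Rightarrow> (complex \<Rightarrow> complex) \<Rightarrow> bool" where
  "local_inverse_at0 F G \<longleftrightarrow>
     G analytic_on {0} \<and> G 0 = 0 \<and>
     (\<forall>\<^sub>F w in nhds 0. F (G w) = w) \<and> (\<forall>\<^sub>F z in nhds 0. G (F z) = z)"

definition class_B :: "(complex \<Rightarrow> complex) \<Rightarrow> (complex \<Rightarrow> complex) \<Rightarrow> (complex \<Rightarrow> complex) set" where
  "class_B \<phi> \<psi> = {G. \<exists>F\<in>class_A \<phi> \<psi>. local_inverse_at0 F G}"

end

theory Submission
  imports Defs
begin

text \<open>
  By the Schwarz lemma \<open>\<omega> z = z * g z\<close>, where \<open>g\<close> is holomorphic and either a unimodular constant or
  a map of the disk into itself. Composing power series expresses \<open>b\<^sub>2\<close> and \<open>b\<^sub>3\<close> by \<open>g 0 = \<gamma>1\<close> and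
  \<open>g' 0\<close> only (\<open>inverse_coeffs\<close>): \<open>b\<^sub>2\<close> is an affine function of \<open>\<gamma>1\<close>, and
  \<open>b\<^sub>3 = c1 - b\<^sup>4 \<alpha>\<^sub>1 \<beta>\<^sub>1 (g' 0)\<close>. The three statements are readings of this formula.

  If \<open>\<beta> 1 \<noteq> 0\<close>, then \<open>b\<^sub>3\<close> is on the circle exactly when \<open>\<bar>g' 0\<bar> = 1 - \<bar>\<gamma>1\<bar>\<^sup>2\<close>, which is equality
  in the Schwarz-Pick inequality at the origin. Equality means that \<open>g\<close> is a disk automorphism or a
  unimodular constant (\<open>extremal_second_coeff_iff\<close>), that is, alternative (ii) or \<open>\<bar>\<gamma>1\<bar> = 1\<close>. The
  latter is alternative (i), because \<open>b\<^sub>2\<close> determines \<open>\<gamma>1\<close>; then \<open>\<omega>\<close> is a rotation and \<open>g' 0 = 0\<close>.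

  If \<open>\<beta> 1 = 0\<close>, the derivative of \<open>g\<close> drops out and \<open>b\<^sub>3 = c2 - b\<^sup>4 \<alpha>\<^sub>1 \<beta>\<^sub>2 \<gamma>1\<^sup>2\<close>. If also \<open>\<beta> 2 = 0\<close>,
  only \<open>c2\<close> remains; otherwise \<open>b\<^sub>3\<close> is on the circle exactly when \<open>\<bar>\<gamma>1\<bar> = 1\<close>, where \<open>\<omega>\<close> is
  again a rotation.
\<close>

section \<open>Coefficients of the inverse\<close>

unbundle no vec_syntax

lemma eventually_in_unit_disk: "\<forall>\<^sub>F z in nhds 0. z \<in> ball (0::complex) 1"
  by (intro eventually_nhds_in_open) auto

lemma fps_left_inverse_coeffs:
  fixes A B :: "complex fps"
  assumes "fps_compose B A = fps_X" "A $ 0 = 0" "A $ 1 \<noteq> 0"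
  shows "B $ 2 = - (A $ 2) / (A $ 1)^3"
    and "B $ 3 = (2 * (A $ 2)^2 - A $ 1 * A $ 3) / (A $ 1)^5"
proof -
  have 1: "B $ 1 * A $ 1 = 1"
    using arg_cong[OF assms(1), of "\<lambda>f. f $ 1"] assms(2)
    by (simp add: fps_compose_nth)
  have 2: "B $ 1 * A $ 2 + B $ 2 * (A $ 1)^2 = 0"
    using arg_cong[OF assms(1), of "\<lambda>f. f $ 2"] assms(2)
    by (simp add: fps_compose_nth fps_mult_nth eval_nat_numeral)
  have 3: "B $ 1 * A $ 3 + B $ 2 * (2 * A $ 1 * A $ 2) + B $ 3 * (A $ 1)^3 = 0"
    using arg_cong[OF assms(1), of "\<lambda>f. f $ 3"] assms(2)
    by (simp add: fps_compose_nth fps_mult_nth eval_nat_numeral algebra_simps)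
  have b1: "B $ 1 = 1 / A $ 1"
    using 1 assms(3) by (simp add: field_simps)
  have "B $ 2 * (A $ 1)^3 = - (A $ 2)"
    using 2 assms(3) unfolding b1 by (simp add: field_simps power2_eq_square power3_eq_cube eq_neg_iff_add_eq_0)
  then show b2: "B $ 2 = - (A $ 2) / (A $ 1)^3"
    using assms(3) by (simp add: field_simps)
  have "B $ 3 * (A $ 1)^3 = - (B $ 1 * A $ 3 + B $ 2 * (2 * A $ 1 * A $ 2))"
    unfolding eq_neg_iff_add_eq_0 using 3 by (simp add: ac_simps)
  also have "\<dots> = (2 * (A $ 2)^2 - A $ 1 * A $ 3) / (A $ 1)^2"
    unfolding b1 b2 using assms(3)
    by (simp add: field_simps power2_eq_square power3_eq_cube)
  finally show "B $ 3 = (2 * (A $ 2)^2 - A $ 1 * A $ 3) / (A $ 1)^5"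
    using assms(3) by (simp add: field_simps eval_nat_numeral)
qed

text \<open>
  Reading \<open>G (F z) = z\<close> as an identity of power series determines the coefficients of \<open>G\<close>.
  Using the factor \<open>g\<close> in place of \<open>\<omega>\<close> turns the second coefficient of \<open>\<omega>\<close> into a first derivative,
  to which the Schwarz-Pick inequality applies.
\<close>

lemma inverse_coeffs:
  fixes \<phi> \<psi> g F G :: "complex \<Rightarrow> complex" and \<alpha> \<beta> c :: "nat \<Rightarrow> complex"
  assumes \<phi>: "\<And>z. z \<in> ball 0 1 \<Longrightarrow> (\<lambda>k. \<alpha> (Suc k) * z ^ Suc k) sums \<phi> z"
    and \<psi>: "\<And>z. z \<in> ball 0 1 \<Longrightarrow> (\<lambda>k. \<beta> k * z ^ k) sums \<psi> z"
    and nz: "\<alpha> 1 \<noteq> 0" "\<beta> 0 \<noteq> 0"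
    and g: "g holomorphic_on ball 0 1"
    and F: "\<And>z. z \<in> ball 0 1 \<Longrightarrow> F z = \<phi> z * \<psi> (z * g z)"
    and FG: "local_inverse_at0 F G"
    and c: "\<forall>\<^sub>F z in nhds 0. (\<lambda>k. c (Suc k) * z ^ Suc k) sums G z"
    and b: "b = 1 / (\<alpha> 1 * \<beta> 0)"
  shows "c 2 = - (\<alpha> 2 * \<beta> 0 + \<alpha> 1 * \<beta> 1 * g 0) * b^3"
    and "c 3 = b^5 * ((\<beta> 0)^2 * (2 * (\<alpha> 2)^2 - \<alpha> 1 * \<alpha> 3) 
           + 3 * \<alpha> 1 * \<beta> 0 * \<alpha> 2 * \<beta> 1 * g 0 
           + (\<alpha> 1)^2 * (2 * (\<beta> 1)^2 - \<beta> 0 * \<beta> 2) * (g 0)^2)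
         - b^4 * (\<alpha> 1 * \<beta> 1) * deriv g 0"
proof -
  \<comment> \<open>The assumptions say nothing about the values of \<open>\<alpha>\<close> and \<open>c\<close> at 0, so those entries are reset.\<close>
  define P where "P = Abs_fps (\<lambda>n. if n = 0 then 0 else \<alpha> n)"
  define Q where "Q = Abs_fps \<beta>"
  define C where "C = Abs_fps (\<lambda>n. if n = 0 then 0 else c n)"
  define W where "W = fps_expansion g 0"
  have P: "\<phi> has_fps_expansion P"
  proof (rule has_fps_expansionI, rule eventually_mono[OF eventually_in_unit_disk])
    fix z :: complex assume "z \<in> ball 0 1"
    from \<phi>[OF this] show "(\<lambda>n. P $ n * z ^ n) sums \<phi> z"
      using sums_Suc_iff[of "\<lambda>n. P $ n * z ^ n" "\<phi> z"] by (simp add: P_def)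
  qed
  have Q: "\<psi> has_fps_expansion Q"
    using \<psi> by (intro has_fps_expansionI eventually_mono[OF eventually_in_unit_disk]) (simp add: Q_def)
  have C: "G has_fps_expansion C"
  proof (rule has_fps_expansionI, rule eventually_mono[OF c])
    fix z :: complex assume "(\<lambda>k. c (Suc k) * z ^ Suc k) sums G z"
    then show "(\<lambda>n. C $ n * z ^ n) sums G z"
      using sums_Suc_iff[of "\<lambda>n. C $ n * z ^ n" "G z"] by (simp add: C_def)
  qed
  have W: "g has_fps_expansion W"
    unfolding W_def using g
    by (intro analytic_at_imp_has_fps_expansion_0) (auto simp: analytic_at intro!: exI[of _ "ball 0 1"])
  have W01: "W $ 0 = g 0" "W $ Suc 0 = deriv g 0"
    by (simp_all add: W_def fps_expansion_def)
  define A where "A = P * fps_compose Q (fps_X * W)"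
  have "(\<lambda>z. \<phi> z * (\<psi> \<circ> (\<lambda>z. z * g z)) z) has_fps_expansion A"
    unfolding A_def
    by (intro has_fps_expansion_mult has_fps_expansion_compose P Q W has_fps_expansion_fps_X)
       (auto simp: fps_mult_nth)
  then have A: "F has_fps_expansion A"
    by (subst has_fps_expansion_cong[OF _ refl, where g = "\<lambda>z. \<phi> z * (\<psi> \<circ> (\<lambda>z. z * g z)) z"])
       (use F in \<open>auto intro: eventually_mono[OF eventually_in_unit_disk]\<close>)
  have A0: "A $ 0 = 0" by (simp add: A_def P_def)
  have P0: "P $ 0 = 0" and Pn: "P $ 1 = \<alpha> 1" "P $ 2 = \<alpha> 2" "P $ 3 = \<alpha> 3" 
    by (simp_all add: P_def)
  define R where "R = fps_compose Q (fps_X * W)"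
  have R: "R $ 0 = \<beta> 0" "R $ 1 = \<beta> 1 * g 0" "R $ 2 = \<beta> 1 * deriv g 0 + \<beta> 2 * (g 0)^2"
    by (simp_all add: R_def fps_compose_nth Q_def W01 power_mult_distrib fps_X_power_mult_nth
          numeral_2_eq_2 power2_eq_square)
  have A1: "A $ 1 = \<alpha> 1 * \<beta> 0"
    using R P0 Pn unfolding A_def R_def[symmetric] by (simp add: fps_mult_nth)
  have A2: "A $ 2 = \<alpha> 2 * \<beta> 0 + \<alpha> 1 * (\<beta> 1 * g 0)"
    using R P0 Pn unfolding A_def R_def[symmetric] by (simp add: fps_mult_nth eval_nat_numeral)
  have A3: "A $ 3 = \<alpha> 3 * \<beta> 0 + \<alpha> 2 * (\<beta> 1 * g 0) + \<alpha> 1 * (\<beta> 1 * deriv g 0 + \<beta> 2 * (g 0)^2)"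
    using R P0 Pn unfolding A_def R_def[symmetric] by (simp add: fps_mult_nth eval_nat_numeral)
  have "(G \<circ> F) has_fps_expansion fps_compose C A"
    by (intro has_fps_expansion_compose A C A0)
  moreover have "(G \<circ> F) has_fps_expansion fps_X"
    by (subst has_fps_expansion_cong[OF _ refl, where g = "\<lambda>z. z"])
       (use FG in \<open>auto simp: local_inverse_at0_def intro: has_fps_expansion_fps_X\<close>)
  ultimately have CA: "fps_compose C A = fps_X"
    by (rule fps_expansion_unique_complex)
  have A1nz: "A $ 1 \<noteq> 0" using nz A1 by simp
  have C2: "c 2 = C $ 2" and C3: "c 3 = C $ 3"
    by (simp_all add: C_def)
  note co = fps_left_inverse_coeffs[OF CA A0 A1nz]
  show "c 2 = - (\<alpha> 2 * \<beta> 0 + \<alpha> 1 * \<beta> 1 * g 0) * b^3"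
    using co(1) unfolding C2 A1 A2 b by (simp add: power_one_over field_simps)
  have b5: "b ^ 4 = \<alpha> 1 * \<beta> 0 * b ^ 5"
    using nz b by (simp add: eval_nat_numeral)
  have "c 3 = (2 * (\<alpha> 2 * \<beta> 0 + \<alpha> 1 * (\<beta> 1 * g 0))^2 - \<alpha> 1 * \<beta> 0 * 
     (\<alpha> 3 * \<beta> 0 + \<alpha> 2 * (\<beta> 1 * g 0) + \<alpha> 1 * (\<beta> 1 * deriv g 0 + \<beta> 2 * (g 0)^2))) * b ^ 5"
    using co(2) unfolding C3 A1 A2 A3 b by (simp add: power_one_over)
  then show "c 3 = b^5 * ((\<beta> 0)^2 * (2 * (\<alpha> 2)^2 - \<alpha> 1 * \<alpha> 3) 
           + 3 * \<alpha> 1 * \<beta> 0 * \<alpha> 2 * \<beta> 1 * g 0 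
           + (\<alpha> 1)^2 * (2 * (\<beta> 1)^2 - \<beta> 0 * \<beta> 2) * (g 0)^2)
         - b^4 * (\<alpha> 1 * \<beta> 1) * deriv g 0"
    unfolding b5 by (simp add: algebra_simps power2_eq_square)
qed

section \<open>The equality case of the Schwarz-Pick inequality at the origin\<close>

lemma disk_self_map0D:
  assumes "disk_self_map0 \<omega>"
  shows "\<omega> holomorphic_on ball 0 1" "\<omega> 0 = 0" "\<And>z. cmod z < 1 \<Longrightarrow> cmod (\<omega> z) < 1"
  using assms by (auto simp: disk_self_map0_def image_subset_iff)

lemma disk_self_map0_factor:
  assumes "disk_self_map0 \<omega>"
  obtains g where "g holomorphic_on ball 0 1" "\<And>z. z \<in> ball 0 1 \<Longrightarrow> \<omega> z = z * g z" 
    "g 0 = deriv \<omega> 0"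
  using Schwarz3[OF disk_self_map0D(1,2)[OF assms]] by (metis mem_ball_0)

lemma deriv_of_linear_on_disk:
  assumes "\<And>z. cmod z < 1 \<Longrightarrow> f z = a * z"
  shows "deriv f 0 = a"
proof -
  have "deriv f 0 = deriv (\<lambda>z. a * z) 0"
    using assms by (intro deriv_cong_ev) (auto intro: eventually_mono[OF eventually_in_unit_disk])
  then show ?thesis by simp
qed

lemma rotation_if_unimodular_deriv:
  assumes "disk_self_map0 \<omega>" "cmod (deriv \<omega> 0) = 1" "z \<in> ball 0 1"
  shows "\<omega> z = deriv \<omega> 0 * z"
proof -
  note D = disk_self_map0D[OF assms(1)]
  obtain a where a: "\<And>z. cmod z < 1 \<Longrightarrow> \<omega> z = a * z"
    using Schwarz_Lemma(3)[OF D, of 0] assms(2) by auto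
  then show ?thesis
    using deriv_of_linear_on_disk[of \<omega> a] a assms(3) by simp
qed

text \<open>
  The Schwarz lemma gives only \<open>\<bar>g z\<bar> \<le> 1\<close>. Equality at one point would make \<open>\<omega>\<close> a rotation, and
  then its derivative at 0 would be unimodular.
\<close>

lemma factor_maps_into_disk:
  assumes "disk_self_map0 \<omega>" "cmod (deriv \<omega> 0) < 1"
    and g: "\<And>z. z \<in> ball 0 1 \<Longrightarrow> \<omega> z = z * g z" "g 0 = deriv \<omega> 0"
    and z: "cmod z < 1"
  shows "cmod (g z) < 1"
proof (cases "z = 0")
  case True
  then show ?thesis using assms by simp
next
  case False
  note D = disk_self_map0D[OF assms(1)]
  have "cmod (\<omega> z) \<le> cmod z"
    using Schwarz_Lemma(1)[OF D z] by simp
  moreover have "cmod (\<omega> z) \<noteq> cmod z"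
  proof
    assume "cmod (\<omega> z) = cmod z"
    then obtain a where a: "\<And>z. cmod z < 1 \<Longrightarrow> \<omega> z = a * z" "cmod a = 1"
      using Schwarz_Lemma(3)[OF D z] False z by blast
    then show False
      using deriv_of_linear_on_disk[of \<omega> a] assms(2) by simp
  qed
  ultimately have "cmod z * cmod (g z) < cmod z * 1"
    using g(1)[of z] z by (simp add: norm_mult)
  then show ?thesis
    using False by simp
qed

lemma deriv_Moebius_function_self:
  assumes "cmod w < 1"
  shows "(Moebius_function 0 w has_field_derivative 1 / of_real (1 - (cmod w)^2)) (at w)"
proof -
  have *: "1 - cnj w * w = of_real (1 - (cmod w)^2)"
    using complex_norm_square[of w] by (simp add: mult.commute)
  have "(cmod w)^2 < 1"
    using assms by (simp add: abs_square_less_1)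
  then have nz: "1 - cnj w * w \<noteq> 0"
    unfolding * of_real_eq_0_iff by simp
  have "((\<lambda>z. (z - w) / (1 - cnj w * z)) has_field_derivative 1 / (1 - cnj w * w)) (at w)"
    using nz by (auto intro!: derivative_eq_intros)
  then show ?thesis
    unfolding * by (simp add: Moebius_function_simple[abs_def])
qed

text \<open>
  Following \<open>g\<close> by the automorphism that sends \<open>g 0\<close> to 0 gives a map fixing 0, whose derivative
  there is \<open>g' 0 / (1 - \<bar>g 0\<bar>\<^sup>2)\<close>. Here this is unimodular, so the map is a rotation by the equality
  case of the Schwarz lemma, and applying the inverse automorphism recovers \<open>g\<close>.
\<close>

lemma Schwarz_Pick_extremal:
  assumes hol: "g holomorphic_on ball 0 1" and lt: "\<And>z. cmod z < 1 \<Longrightarrow> cmod (g z) < 1"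
    and eq: "cmod (deriv g 0) = 1 - (cmod (g 0))^2"
  obtains \<theta> where "\<And>z. z \<in> ball 0 1 \<Longrightarrow> g z = (g 0 + z * cis \<theta>) / (1 + cnj (g 0) * z * cis \<theta>)"
proof -
  define w where "w = g 0"
  have w: "cmod w < 1" using lt[of 0] by (simp add: w_def)
  then have w2: "(cmod w)^2 < 1"
    by (simp add: abs_square_less_1)
  define h where "h = Moebius_function 0 w \<circ> g"
  have holh: "h holomorphic_on ball 0 1"
    unfolding h_def
    by (rule holomorphic_on_compose_gen[OF hol Moebius_function_holomorphic[OF w]]) (use lt in auto)
  have h0: "h 0 = 0" by (simp add: h_def w_def Moebius_function_eq_zero)
  have hlt: "cmod (h z) < 1" if "cmod z < 1" for z
    using Moebius_function_norm_lt_1[OF w lt[OF that]] by (simp add: h_def)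
  have "(g has_field_derivative deriv g 0) (at 0)"
    using hol by (intro holomorphic_derivI[of _ "ball 0 1"]) auto
  then have "(h has_field_derivative 1 / of_real (1 - (cmod w)^2) * deriv g 0) (at 0)"
    unfolding h_def by (intro DERIV_chain) (use deriv_Moebius_function_self[OF w] in \<open>simp_all add: w_def\<close>)
  then have "deriv h 0 = 1 / of_real (1 - (cmod w)^2) * deriv g 0"
    by (rule DERIV_imp_deriv)
  then have "cmod (deriv h 0) = 1"
    using eq w2 by (simp add: norm_divide norm_mult w_def[symmetric] del: of_real_diff)
  then obtain a where a: "\<And>z. cmod z < 1 \<Longrightarrow> h z = a * z" "cmod a = 1"
    using Schwarz_Lemma(3)[OF holh h0 hlt, of 0] by auto
  have cis: "a = cis (Arg a)"
    using a(2) by (subst cis_Arg) (auto simp: sgn_eq)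
  show ?thesis
  proof
    fix z :: complex assume z: "z \<in> ball 0 1"
    then have "g z = Moebius_function 0 (- w) (Moebius_function 0 w (g z))"
      using w lt by (intro Moebius_function_compose[symmetric]) auto
    also have "Moebius_function 0 w (g z) = a * z"
      using a(1)[of z] z by (simp add: h_def)
    finally show "g z = (g 0 + z * cis (Arg a)) / (1 + cnj (g 0) * z * cis (Arg a))"
      unfolding cis[symmetric] by (simp add: Moebius_function_simple w_def algebra_simps)
  qed
qed

lemma deriv_disk_automorphism_0:
  assumes eq: "\<And>z. z \<in> ball 0 1 \<Longrightarrow> g z = (c + z * e) / (1 + cnj c * z * e)"
  shows "deriv g 0 = e * of_real (1 - (cmod c)^2)"
proof -
  have "deriv g 0 = deriv (\<lambda>z. (c + z * e) / (1 + cnj c * z * e)) 0"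
    using eq by (intro deriv_cong_ev) (auto intro: eventually_mono[OF eventually_in_unit_disk])
  also have "\<dots> = e * (1 - c * cnj c)"
    by (rule DERIV_imp_deriv) (auto intro!: derivative_eq_intros simp: algebra_simps)
  also have "c * cnj c = of_real ((cmod c)^2)"
    by (simp only: complex_norm_square)
  finally show ?thesis by simp
qed


lemma factor_of_rotation:
  assumes "disk_self_map0 \<omega>" "cmod (deriv \<omega> 0) = 1"
    and g: "\<And>z. z \<in> ball 0 1 \<Longrightarrow> \<omega> z = z * g z" "g 0 = deriv \<omega> 0"
    and z: "z \<in> ball 0 1"
  shows "g z = g 0"
  using rotation_if_unimodular_deriv[OF assms(1,2) z] g(1)[OF z] g(2) by (cases "z = 0") auto

text \<open>
  The number \<open>deriv g 0\<close> is the second Taylor coefficient of \<open>\<omega>\<close>. If \<open>\<bar>g 0\<bar> = 1\<close>, both sides hold: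
  \<open>g\<close> is constant, and so its derivative vanishes. If \<open>\<bar>g 0\<bar> < 1\<close>, then \<open>g\<close> maps into the open
  disk and the equality case of Schwarz-Pick applies; conversely, the derivative of the automorphism
  at 0 is \<open>cis \<theta> * (1 - \<bar>g 0\<bar>\<^sup>2)\<close>.
\<close>

lemma extremal_second_coeff_iff:
  assumes \<omega>: "disk_self_map0 \<omega>" and hol: "g holomorphic_on ball 0 1"
    and g: "\<And>z. z \<in> ball 0 1 \<Longrightarrow> \<omega> z = z * g z" "g 0 = deriv \<omega> 0"
  shows "cmod (deriv g 0) = 1 - (cmod (g 0))^2 \<longleftrightarrow>
     cmod (g 0) = 1 \<or>
     (\<exists>\<theta>. \<forall>z\<in>ball 0 1. \<omega> z = z * ((g 0 + z * cis \<theta>) / (1 + cnj (g 0) * z * cis \<theta>)))"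
    (is "?L \<longleftrightarrow> ?R1 \<or> (\<exists>\<theta>. ?R2 \<theta>)")
proof -
  have le: "cmod (g 0) \<le> 1"
    using Schwarz_Lemma(2)[OF disk_self_map0D[OF \<omega>], of 0] g(2) by simp
  have L1: ?L if 1: ?R1
  proof -
    \<comment> \<open>A constant is the degenerate case of the automorphism formula with \<open>0\<close> as rotation factor.\<close>
    have "g z = (g 0 + z * 0) / (1 + cnj (g 0) * z * 0)" if "z \<in> ball 0 1" for z
      using factor_of_rotation[OF \<omega> _ g that] 1 g(2) by simp
    from deriv_disk_automorphism_0[OF this] show ?thesis
      using 1 by simp
  qed
  have L2: ?L if 2: "?R2 \<theta>" for \<theta>
  proof -
    have "g z = (g 0 + z * cis \<theta>) / (1 + cnj (g 0) * z * cis \<theta>)" if "z \<in> ball 0 1" for z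
    proof (cases "z = 0")
      case False
      have "z * g z = z * ((g 0 + z * cis \<theta>) / (1 + cnj (g 0) * z * cis \<theta>))"
        using 2 g(1)[OF that] that by metis
      then show ?thesis
        using False by (simp only: mult_left_cancel not_False_eq_True)
    qed simp
    from deriv_disk_automorphism_0[OF this] 
    have "cmod (deriv g 0) = \<bar>1 - (cmod (g 0))^2\<bar>"
      by (simp add: norm_mult del: of_real_diff)
    then show ?thesis
      using le by (simp add: abs_square_le_1)
  qed
  have "\<exists>\<theta>. ?R2 \<theta>" if L: ?L and n1: "\<not> ?R1"
  proof -
    have lt: "cmod (g z) < 1" if "cmod z < 1" for z
      using factor_maps_into_disk[OF \<omega> _ g that] le n1 g(2) by simp
    show ?thesis
      using Schwarz_Pick_extremal[OF hol lt L] g(1) by metis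
  qed
  with L1 L2 show ?thesis by blast
qed

section \<open>Extremal third coefficients\<close>

lemma local_inverse_at0_cong:
  assumes FG: "local_inverse_at0 F G" and FH: "\<forall>\<^sub>F z in nhds 0. F z = H z"
  shows "local_inverse_at0 H G"
proof -
  have an: "G analytic_on {0}" and G0: "G 0 = 0"
    and 1: "\<forall>\<^sub>F w in nhds 0. F (G w) = w" and 2: "\<forall>\<^sub>F z in nhds 0. G (F z) = z"
    using FG by (auto simp: local_inverse_at0_def)
  have "filterlim G (nhds 0) (nhds 0)"
    using analytic_at_imp_isCont[OF an] G0 by (simp add: isCont_def tendsto_nhds_iff)
  then have "\<forall>\<^sub>F w in nhds 0. F (G w) = H (G w)"
    using FH by (rule eventually_compose_filterlim[rotated])
  with 1 have "\<forall>\<^sub>F w in nhds 0. H (G w) = w"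
    by eventually_elim simp
  moreover from 2 FH have "\<forall>\<^sub>F z in nhds 0. G (H z) = z"
    by eventually_elim simp
  ultimately show ?thesis
    using an G0 by (simp add: local_inverse_at0_def)
qed

lemma norm_eq_1_iff_cis: "cmod z = 1 \<longleftrightarrow> (\<exists>\<xi>. z = cis \<xi>)"
  by (metis norm_cis complex_norm_eq_1_exp cis_conv_exp)

theorem theorem4p4:
  fixes \<phi> \<psi> \<omega> F G :: "complex \<Rightarrow> complex"
    and \<alpha> \<beta> bk :: "nat \<Rightarrow> complex"
    and b \<alpha>t \<beta>t \<gamma>1 c1 c2 :: complex
    and \<rho>1 \<rho>2 :: real
  assumes "\<phi> holomorphic_on ball 0 1"
    and "\<And>z. z \<in> ball 0 1 \<Longrightarrow> (\<lambda>k. \<alpha> (Suc k) * z ^ Suc k) sums \<phi> z"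
    and "\<psi> holomorphic_on ball 0 1"
    and "\<And>z. z \<in> ball 0 1 \<Longrightarrow> (\<lambda>k. \<beta> k * z ^ k) sums \<psi> z"
    and "\<alpha> 1 \<noteq> 0" and "\<beta> 0 \<noteq> 0"
    and "b = 1 / (\<alpha> 1 * \<beta> 0)"
    and "\<alpha>t = 2 * (\<alpha> 2)^2 - \<alpha> 1 * \<alpha> 3"
    and "\<beta>t = 2 * (\<beta> 1)^2 - \<beta> 0 * \<beta> 2"
    and "F \<in> class_A \<phi> \<psi>"
    and "disk_self_map0 \<omega>"
    and "\<And>z. z \<in> ball 0 1 \<Longrightarrow> F z = \<phi> z * \<psi> (\<omega> z)"
    and "\<gamma>1 = deriv \<omega> 0"
    and "G \<in> class_B \<phi> \<psi>"
    and "local_inverse_at0 F G"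
    and "\<forall>\<^sub>F z in nhds 0. (\<lambda>k. bk (Suc k) * z ^ Suc k) sums G z"
    and "c1 = b^5 * ((\<beta> 0)^2 * \<alpha>t + 3 * \<alpha> 1 * \<beta> 0 * \<alpha> 2 * \<beta> 1 * \<gamma>1 + (\<alpha> 1)^2 * \<beta>t * \<gamma>1^2)"
    and "\<rho>1 = (cmod b)^4 * cmod (\<alpha> 1 * \<beta> 1) * (1 - (cmod \<gamma>1)^2)"
    and "c2 = b^5 * (\<beta> 0)^2 * \<alpha>t"
    and "\<rho>2 = (cmod b)^4 * cmod (\<alpha> 1 * \<beta> 2)"
  shows
    "(\<beta> 1 \<noteq> 0 \<longrightarrow>
        (bk 3 \<in> sphere c1 \<rho>1 \<longleftrightarrow>
           (\<exists>\<xi>::real. bk 2 = - (\<alpha> 2 * \<beta> 0 + \<alpha> 1 * \<beta> 1 * cis \<xi>) * b^3) \<or>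
           (\<exists>\<theta>::real. \<forall>z\<in>ball 0 1. F z = \<phi> z * \<psi> (\<omega> z) \<and>
              \<omega> z = z * ((\<gamma>1 + z * cis \<theta>) / (1 + cnj \<gamma>1 * z * cis \<theta>)))) \<and>
        (\<forall>\<xi>::real. bk 2 = - (\<alpha> 2 * \<beta> 0 + \<alpha> 1 * \<beta> 1 * cis \<xi>) * b^3 \<longrightarrow>
           bk 3 = c1 \<and>
           (\<forall>z\<in>ball 0 1. F z = \<phi> z * \<psi> (\<omega> z) \<and> \<omega> z = cis \<xi> * z)))
     \<and>
     (\<beta> 1 = 0 \<and> \<beta> 2 = 0 \<longrightarrow> bk 3 = b^5 * (\<beta> 0)^2 * \<alpha>t)
     \<and>
     (\<beta> 1 = 0 \<and> \<beta> 2 \<noteq> 0 \<longrightarrow>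
        (bk 3 \<in> sphere c2 \<rho>2 \<longleftrightarrow>
           (\<exists>\<theta>::real. (\<lambda>z. \<phi> z * \<psi> (cis \<theta> * z)) \<in> class_A \<phi> \<psi> \<and>
              local_inverse_at0 (\<lambda>z. \<phi> z * \<psi> (cis \<theta> * z)) G)) \<and>
        (\<forall>\<theta>::real. (\<lambda>z. \<phi> z * \<psi> (cis \<theta> * z)) \<in> class_A \<phi> \<psi> \<and>
              local_inverse_at0 (\<lambda>z. \<phi> z * \<psi> (cis \<theta> * z)) G \<longrightarrow>
           bk 3 = \<alpha>t * (\<beta> 0)^2 * b^5 - \<alpha> 1 * \<beta> 2 * cis (2 * \<theta>) * b^4))"
proof -
  obtain g where hol: "g holomorphic_on ball 0 1"
    and g: "\<And>z. z \<in> ball 0 1 \<Longrightarrow> \<omega> z = z * g z" "g 0 = deriv \<omega> 0"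
    using disk_self_map0_factor[OF assms(11)] by blast
  have F: "F z = \<phi> z * \<psi> (z * g z)" if "z \<in> ball 0 1" for z
    using assms(12)[OF that] g(1)[OF that] by simp
  have g0: "g 0 = \<gamma>1" using g(2) assms(13) by simp
  have b: "b \<noteq> 0" using assms(5-7) by simp
  note coeffs = inverse_coeffs[where \<alpha> = \<alpha> and \<beta> = \<beta> and c = bk, OF assms(2,4,5,6) hol F assms(15,16,7), unfolded g0]
  have rot: "\<omega> z = \<gamma>1 * z" if "cmod \<gamma>1 = 1" "z \<in> ball 0 1" for z
    using rotation_if_unimodular_deriv[OF assms(11)] that assms(13) by simp
  have bk2: "bk 2 = - (\<alpha> 2 * \<beta> 0 + \<alpha> 1 * \<beta> 1 * \<gamma>1) * b^3"
    by (rule coeffs(1))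
  have bk3: "bk 3 = c1 - b^4 * (\<alpha> 1 * \<beta> 1) * deriv g 0"
    using coeffs(2) by (simp add: assms(17,8,9))
  have part1: "\<beta> 1 \<noteq> 0 \<longrightarrow>
        (bk 3 \<in> sphere c1 \<rho>1 \<longleftrightarrow>
           (\<exists>\<xi>::real. bk 2 = - (\<alpha> 2 * \<beta> 0 + \<alpha> 1 * \<beta> 1 * cis \<xi>) * b^3) \<or>
           (\<exists>\<theta>::real. \<forall>z\<in>ball 0 1. F z = \<phi> z * \<psi> (\<omega> z) \<and>
              \<omega> z = z * ((\<gamma>1 + z * cis \<theta>) / (1 + cnj \<gamma>1 * z * cis \<theta>)))) \<and>
        (\<forall>\<xi>::real. bk 2 = - (\<alpha> 2 * \<beta> 0 + \<alpha> 1 * \<beta> 1 * cis \<xi>) * b^3 \<longrightarrow>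
           bk 3 = c1 \<and>
           (\<forall>z\<in>ball 0 1. F z = \<phi> z * \<psi> (\<omega> z) \<and> \<omega> z = cis \<xi> * z))"
  proof (intro impI)
    assume \<beta>1: "\<beta> 1 \<noteq> 0"
    have circle: "bk 3 \<in> sphere c1 \<rho>1 \<longleftrightarrow> cmod (deriv g 0) = 1 - (cmod \<gamma>1)^2"
      using b \<beta>1 assms(5) by (simp add: bk3 assms(18) dist_norm norm_mult norm_power)
    \<comment> \<open>The map from \<open>\<gamma>1\<close> to \<open>bk 2\<close> is affine with nonzero slope, hence injective.\<close>
    have b2: "bk 2 = - (\<alpha> 2 * \<beta> 0 + \<alpha> 1 * \<beta> 1 * cis \<xi>) * b^3 \<longleftrightarrow> \<gamma>1 = cis \<xi>" for \<xi>
      using b \<beta>1 assms(5) by (simp add: bk2 del: minus_add_distrib)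
    have ext: "cmod (deriv g 0) = 1 - (cmod \<gamma>1)^2 \<longleftrightarrow> cmod \<gamma>1 = 1 \<or>
        (\<exists>\<theta>. \<forall>z\<in>ball 0 1. \<omega> z = z * ((\<gamma>1 + z * cis \<theta>) / (1 + cnj \<gamma>1 * z * cis \<theta>)))"
      using extremal_second_coeff_iff[OF assms(11) hol g] unfolding g0 by blast
    have 1: "bk 3 \<in> sphere c1 \<rho>1 \<longleftrightarrow>
           (\<exists>\<xi>::real. bk 2 = - (\<alpha> 2 * \<beta> 0 + \<alpha> 1 * \<beta> 1 * cis \<xi>) * b^3) \<or>
           (\<exists>\<theta>::real. \<forall>z\<in>ball 0 1. F z = \<phi> z * \<psi> (\<omega> z) \<and>
              \<omega> z = z * ((\<gamma>1 + z * cis \<theta>) / (1 + cnj \<gamma>1 * z * cis \<theta>)))"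
      unfolding circle b2 ext norm_eq_1_iff_cis using assms(12) by simp
    have 2: "bk 3 = c1 \<and> (\<forall>z\<in>ball 0 1. F z = \<phi> z * \<psi> (\<omega> z) \<and> \<omega> z = cis \<xi> * z)"
      if "bk 2 = - (\<alpha> 2 * \<beta> 0 + \<alpha> 1 * \<beta> 1 * cis \<xi>) * b^3" for \<xi>
    proof -
      have \<gamma>: "\<gamma>1 = cis \<xi>" using that unfolding b2 .
      then have "cmod (deriv g 0) = 0" using ext by simp
      then show ?thesis
        using rot \<gamma> assms(12) by (simp add: bk3)
    qed
    from 1 2 show "(bk 3 \<in> sphere c1 \<rho>1 \<longleftrightarrow>
           (\<exists>\<xi>::real. bk 2 = - (\<alpha> 2 * \<beta> 0 + \<alpha> 1 * \<beta> 1 * cis \<xi>) * b^3) \<or>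
           (\<exists>\<theta>::real. \<forall>z\<in>ball 0 1. F z = \<phi> z * \<psi> (\<omega> z) \<and>
              \<omega> z = z * ((\<gamma>1 + z * cis \<theta>) / (1 + cnj \<gamma>1 * z * cis \<theta>)))) \<and>
        (\<forall>\<xi>::real. bk 2 = - (\<alpha> 2 * \<beta> 0 + \<alpha> 1 * \<beta> 1 * cis \<xi>) * b^3 \<longrightarrow>
           bk 3 = c1 \<and>
           (\<forall>z\<in>ball 0 1. F z = \<phi> z * \<psi> (\<omega> z) \<and> \<omega> z = cis \<xi> * z))"
      by blast
  qed
  have b4: "b ^ 4 = \<alpha> 1 * \<beta> 0 * b ^ 5"
    using assms(5-7) by (simp add: eval_nat_numeral)
  have \<beta>1_0: "bk 3 = c2 - b^4 * (\<alpha> 1 * \<beta> 2) * \<gamma>1^2" if "\<beta> 1 = 0"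
    unfolding bk3 assms(17,9,19) b4 using that by (simp add: algebra_simps power2_eq_square)
  have part2: "\<beta> 1 = 0 \<and> \<beta> 2 = 0 \<longrightarrow> bk 3 = b^5 * (\<beta> 0)^2 * \<alpha>t"
    using \<beta>1_0 assms(19) by simp
  \<comment> \<open>The coefficient formula, applied to \<open>\<phi> z * \<psi> (cis \<theta> * z)\<close> in place of \<open>F\<close>:
    as \<open>G\<close> inverts this function too, the constant \<open>cis \<theta>\<close> can take the place of \<open>g\<close>.\<close>
  have rotated: "bk 3 = c2 - b^4 * (\<alpha> 1 * \<beta> 2) * (cis \<theta>)^2" 
    if "\<beta> 1 = 0" and "local_inverse_at0 (\<lambda>z. \<phi> z * \<psi> (cis \<theta> * z)) G" for \<theta>
  proof -
    have "\<phi> z * \<psi> (cis \<theta> * z) = \<phi> z * \<psi> (z * cis \<theta>)" for z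
      by (simp add: mult.commute)
    from inverse_coeffs(2)[OF assms(2,4,5,6) holomorphic_on_const this that(2) assms(16,7)]
    show ?thesis
      unfolding assms(8,19) b4 using that(1) by (simp add: algebra_simps power2_eq_square)
  qed
  have part3: "(bk 3 \<in> sphere c2 \<rho>2 \<longleftrightarrow>
           (\<exists>\<theta>::real. (\<lambda>z. \<phi> z * \<psi> (cis \<theta> * z)) \<in> class_A \<phi> \<psi> \<and>
              local_inverse_at0 (\<lambda>z. \<phi> z * \<psi> (cis \<theta> * z)) G)) \<and>
        (\<forall>\<theta>::real. (\<lambda>z. \<phi> z * \<psi> (cis \<theta> * z)) \<in> class_A \<phi> \<psi> \<and>
              local_inverse_at0 (\<lambda>z. \<phi> z * \<psi> (cis \<theta> * z)) G \<longrightarrow>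
           bk 3 = \<alpha>t * (\<beta> 0)^2 * b^5 - \<alpha> 1 * \<beta> 2 * cis (2 * \<theta>) * b^4)"
    (is "(_ \<longleftrightarrow> (\<exists>\<theta>. ?A \<theta> \<and> ?I \<theta>)) \<and> _")
    if \<beta>: "\<beta> 1 = 0" "\<beta> 2 \<noteq> 0"
  proof -
    have circle: "bk 3 \<in> sphere c2 \<rho>2 \<longleftrightarrow> cmod \<gamma>1 = 1"
      using b \<beta>(2) assms(5)
      by (simp add: \<beta>1_0[OF \<beta>(1)] assms(20) dist_norm norm_mult norm_power abs_square_eq_1)
    have on_circle: "bk 3 \<in> sphere c2 \<rho>2" if "?I \<theta>" for \<theta>
      by (simp add: rotated[OF \<beta>(1) that] assms(20) dist_norm norm_mult norm_power)
    have "\<exists>\<theta>. ?A \<theta> \<and> ?I \<theta>" if on: "bk 3 \<in> sphere c2 \<rho>2"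
    proof -
      obtain \<theta> where \<theta>: "\<gamma>1 = cis \<theta>"
        using on unfolding circle norm_eq_1_iff_cis ..
      have eq: "F z = \<phi> z * \<psi> (cis \<theta> * z)" if "z \<in> ball 0 1" for z
        using assms(12)[OF that] rot[OF _ that] \<theta> by simp
      have "?A \<theta>"
      proof -
        have "F holomorphic_on ball 0 1"
          using assms(10) by (simp add: class_A_def)
        then have "(\<lambda>z. \<phi> z * \<psi> (cis \<theta> * z)) holomorphic_on ball 0 1"
          using eq by (rule holomorphic_transform)
        moreover have "\<forall>z\<in>ball 0 1. \<phi> z * \<psi> (cis \<theta> * z) = \<phi> z * \<psi> (\<omega> z)"
          using eq assms(12) by metis
        ultimately show ?thesis
          using assms(11) unfolding class_A_def by blast
      qed
      moreover have "?I \<theta>"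
        by (intro local_inverse_at0_cong[OF assms(15)])
          (rule eventually_mono[OF eventually_in_unit_disk eq])
      ultimately show ?thesis by blast
    qed
    moreover have "bk 3 = \<alpha>t * (\<beta> 0)^2 * b^5 - \<alpha> 1 * \<beta> 2 * cis (2 * \<theta>) * b^4" if "?I \<theta>" for \<theta>
    proof -
      have "cis (2 * \<theta>) = (cis \<theta>)^2"
        by (simp add: power2_eq_square cis_mult)
      then show ?thesis
        unfolding rotated[OF \<beta>(1) that] assms(19) by (simp add: algebra_simps)
    qed
    ultimately show ?thesis
      using on_circle by meson
  qed
  show ?thesis
    by (rule conjI[OF part1 conjI[OF part2]], rule impI, rule part3) simp_all
qed

end
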